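(* Let $PS=\{\alpha_1A_1\alpha_1^R,\ldots,\alpha_mA_m\alpha_m^R\}$ ($m\ge 1$) be a finite set of palindromic subcircuits and let $T$ be its palindrome trie. Then a sequence $A_{j_1},A_{j_2},\ldots,A_{j_m}$ (an ordering of all the palindromic subcircuits of $PS$, each represented by its middle gate) is a maximal overlap sequence for $PS$ if and only if it belongs to $mos(T)$.
   Context: Gates are treated as symbols of an alphabet, and circuits as strings of gates. A gate $A$ is self-inverting if $AA=I$. For a string $\alpha=A_1A_2\ldots A_k$, $\alpha^R=A_k\ldots A_2A_1$ is its reversal, and $length(\alpha)=k$. A palindromic subcircuit is a string $\alpha\beta\alpha^R$ where $\alpha$ is a (possibly empty) string of self-inverting gates and $\beta$ is a unique gate, not necessarily self-inverting. "Unique" means: in a set $PS=\{\alpha_jA_j\alpha_j^R: 1\le j\le m\}$ the middle gates $A_1,\ldots,A_m$ are pairwise distinct symbols and none of them occurs in any of the strings $\alpha_1,\ldots,\alpha_m$. A palindromic subcircuit $\alpha_jA_j\alpha_j^R$ is represented by its middle gate $A_j$. The overlap $overlap(\alpha_1^R,\alpha_2)$ of $\alpha_1A_1\alpha_1^R$ followed by $\alpha_2A_2\alpha_2^R$ is the longest prefix $\gamma$ of $\alpha_2$ such that $\gamma^R$ is a suffix of $\alpha_1^R$ (so that $\gamma^R\gamma$ is a sequence that cancels to the empty sequence); equivalently, it is the longest common prefix of $\alpha_1$ and $\alpha_2$. An ordering $A_{j_1},\ldots,A_{j_m}$ of all elements of $PS$ is a maximal overlap sequence for $PS$ if it maximizes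 $$\sum_{k=1}^{m-1} length(overlap(\alpha_{j_k}^R,\alpha_{j_{k+1}}))$$ among all orderings of $PS$. The palindrome trie $T$ of $PS$ is the trie (radix tree with one gate per non-root node) storing the strings $\alpha_1A_1,\ldots,\alpha_mA_m$: the root is labeled by the empty string, each non-root node is labeled by a gate, distinct children of a node have distinct labels, and the labels on the root-to-leaf paths spell exactly the strings $\alpha_jA_j$. Hence the leaves are in bijection with, and labeled by, $A_1,\ldots,A_m$. For a (sub)trie $T$ (with more than just a root), the subtries of $T$ are the subtrees rooted at the children of its root. Let the subtries having exactly one leaf have leaf labels $A_1,\ldots,A_p$ ($p\ge0$), and let $T_1,\ldots,T_q$ ($q\ge0$) be the subtries having more than one leaf, $p+q>0$. The set $mos(T)$ of sequences of leaf labels is defined recursively by $$mos(T)=permutation(A_1,\ldots,A_p,mos(T_1),\ldots,mos(T_q)),$$ i.e. $mos(T)$ consists of all sequences obtained by choosing one sequence from each $mos(T_k)$, and concatenating, in an arbitrary order, these $q$ chosen sequences (each kept as a contiguous block) and the $p$ one-term sequences $A_1,\ldots,A_p$. *)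

theory Defs
  imports "HOL-Library.Finite_Map" "HOL-Library.Sublist"
    "HOL-Combinatorics.Multiset_Permutations"
begin

text \<open>
  Gates are symbols of type \<open>'g\<close> and circuits are lists of gates. The meaning of a gate is an
  element of an arbitrary monoid, assigned by \<open>sem\<close>; it is only needed to say that a gate is
  self-inverting.
\<close>

definition self_inverting :: "('g \<Rightarrow> 'u::monoid_mult) \<Rightarrow> 'g \<Rightarrow> bool" where
  "self_inverting sem A \<longleftrightarrow> sem A * sem A = 1"

definition palindromic_subcircuit :: "('g \<Rightarrow> 'u::monoid_mult) \<Rightarrow> 'g list \<Rightarrow> bool" where
  "palindromic_subcircuit sem c \<longleftrightarrow>
     (\<exists>\<alpha> \<beta>. c = \<alpha> @ [\<beta>] @ rev \<alpha> \<and> (\<forall>A\<in>set \<alpha>. self_inverting sem A))"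

text \<open>The string \<open>\<alpha>\<close> and the gate \<open>\<beta>\<close> of \<open>c = \<alpha> @ [\<beta>] @ rev \<alpha>\<close> are determined by \<open>c\<close>.\<close>

definition arm :: "'g list \<Rightarrow> 'g list" where
  "arm c = take (length c div 2) c"

definition middle :: "'g list \<Rightarrow> 'g" where
  "middle c = c ! (length c div 2)"

lemma arm_palindrome [simp]: "arm (\<alpha> @ \<beta> # rev \<alpha>) = \<alpha>"
  by (simp add: arm_def)

lemma middle_palindrome [simp]: "middle (\<alpha> @ \<beta> # rev \<alpha>) = \<beta>"
  by (simp add: middle_def nth_append)

definition palindromic_set :: "('g \<Rightarrow> 'u::monoid_mult) \<Rightarrow> 'g list set \<Rightarrow> bool" where
  "palindromic_set sem PS \<longleftrightarrow>
     finite PS \<and> (\<forall>c\<in>PS. palindromic_subcircuit sem c) \<and>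
     inj_on middle PS \<and> (\<forall>c\<in>PS. \<forall>d\<in>PS. middle c \<notin> set (arm d))"

text \<open>The first argument of \<open>overlap\<close> is the already reversed string \<open>rev \<alpha>\<^sub>1\<close>.\<close>

definition overlap :: "'g list \<Rightarrow> 'g list \<Rightarrow> 'g list" where
  "overlap \<rho> \<alpha> = (ARG_MAX length \<gamma>. prefix \<gamma> \<alpha> \<and> suffix (rev \<gamma>) \<rho>)"

definition total_overlap :: "'g list list \<Rightarrow> nat" where
  "total_overlap cs =
     (\<Sum>k<length cs - 1. length (overlap (rev (arm (cs ! k))) (arm (cs ! (k + 1)))))"

text \<open>Sequences are given by middle gates; \<open>middle\<close> is injective on a palindromic set, so the
  ordering \<open>cs\<close> is determined by \<open>As\<close>.\<close>

definition maximal_overlap_sequence :: "'g list set \<Rightarrow> 'g list \<Rightarrow> bool" where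
  "maximal_overlap_sequence PS As \<longleftrightarrow>
     (\<exists>cs\<in>permutations_of_set PS. As = map middle cs \<and>
        (\<forall>ds\<in>permutations_of_set PS. total_overlap ds \<le> total_overlap cs))"

text \<open>
  The finite map of a node sends the label of each child to the subtrie rooted at that child, so
  distinct children have distinct labels. The label of a non-root node is thus kept in its parent.
\<close>

datatype 'g trie = Trie "('g, 'g trie) fmap"

definition subtrie_rel :: "('g trie \<times> 'g trie) set" where
  "subtrie_rel = {(t, Trie m) |t m. t \<in> fmran' m}"

lemma wf_subtrie_rel: "wf subtrie_rel"
proof (unfold wf_def, intro allI impI)
  fix P :: "'g trie \<Rightarrow> bool" and t
  assume step: "\<forall>x. (\<forall>y. (y, x) \<in> subtrie_rel \<longrightarrow> P y) \<longrightarrow> P x"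
  show "P t"
    by (induction t) (use step in \<open>auto simp: subtrie_rel_def\<close>)
qed

context
  notes conj_cong [fundef_cong]
begin

text \<open>The strings spelled by the root-to-leaf paths; these paths are in bijection with the leaves.\<close>

function paths :: "'g trie \<Rightarrow> 'g list set" where
  "paths (Trie m) =
     (if m = fmempty then {[]}
      else {a # w |a w. \<exists>t. fmlookup m a = Some t \<and> w \<in> paths t})"
  by pat_completeness auto
termination
  by (relation subtrie_rel) (rule wf_subtrie_rel, auto simp: subtrie_rel_def intro: fmran'I)

declare paths.simps [simp del]

text \<open>
  Each child, with label \<open>a\<close> and subtrie \<open>t\<close>, contributes one block \<open>b\<close>: the one-term sequence
  consisting of its leaf label if it has exactly one leaf, and a sequence from \<open>mos t\<close> otherwise.
  The leaf label is the last symbol of \<open>a # w\<close>, which is \<open>a\<close> itself if the child is a leaf.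
\<close>

function mos :: "'g trie \<Rightarrow> 'g list set" where
  "mos (Trie m) =
     {concat bs |as bs. as \<in> permutations_of_set (fmdom' m) \<and>
        list_all2 (\<lambda>a b. \<exists>t. fmlookup m a = Some t \<and>
          (if card (paths t) = 1 then b \<in> {[last (a # w)] |w. w \<in> paths t} else b \<in> mos t)) as bs}"
  by pat_completeness auto
termination
  by (relation subtrie_rel) (rule wf_subtrie_rel, auto simp: subtrie_rel_def intro: fmran'I)

declare mos.simps [simp del]

end

definition palindrome_trie :: "'g list set \<Rightarrow> 'g trie" where
  "palindrome_trie PS = (THE T. paths T = (\<lambda>c. arm c @ [middle c]) ` PS)"

lemma paths_nonempty: "paths t \<noteq> {}"
proof (induction t)
  case (Trie m)
  show ?case
  proof (cases "m = fmempty")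
    case False
    then obtain a t where at: "fmlookup m a = Some t"
      by (metis fmap_ext fmempty_lookup not_None_eq)
    then have "paths t \<noteq> {}"
      using Trie fmran'I by metis
    with at False show ?thesis
      by (auto simp: paths.simps)
  qed (simp add: paths.simps)
qed

lemma Cons_in_paths_iff:
  "a # w \<in> paths (Trie m) \<longleftrightarrow> (\<exists>t. fmlookup m a = Some t \<and> w \<in> paths t)"
  by (auto simp: paths.simps)

lemma paths_inject: "paths s = paths t \<Longrightarrow> s = t"
proof (induction s arbitrary: t)
  case (Trie m)
  obtain n where t: "t = Trie n" by (cases t)
  have iff: "(\<exists>u. fmlookup m a = Some u \<and> w \<in> paths u) \<longleftrightarrow>
      (\<exists>u. fmlookup n a = Some u \<and> w \<in> paths u)" for a w
    using Trie.prems by (simp add: t flip: Cons_in_paths_iff)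
  have "fmlookup m a = fmlookup n a" for a
  proof (cases "fmlookup m a")
    case None
    then have "\<not> (\<exists>u. fmlookup n a = Some u \<and> w \<in> paths u)" for w
      using iff[of a w] by simp
    then have "fmlookup n a = None"
      using paths_nonempty by (cases "fmlookup n a") auto
    with None show ?thesis by simp
  next
    case (Some u)
    then obtain w where "w \<in> paths u" using paths_nonempty by blast
    with iff[of a w] Some obtain v where v: "fmlookup n a = Some v" by auto
    with iff[of a] Some have "paths u = paths v" by auto
    moreover have "u \<in> fmran' m" using Some by (rule fmran'I)
    ultimately have "u = v" using Trie.IH by blast
    with Some v show ?thesis by simp
  qed
  then show ?case by (simp add: t fmap_ext)
qed

lemma ex_trie:
  assumes "finite S" "S \<noteq> {}" "\<And>u v. u \<in> S \<Longrightarrow> v \<in> S \<Longrightarrow> prefix u v \<Longrightarrow> u = v"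
    and "\<And>u. u \<in> S \<Longrightarrow> length u \<le> n"
  shows "\<exists>t. paths t = S"
  using assms
proof (induction n arbitrary: S)
  case 0
  then have "S = {[]}" by auto
  then have "paths (Trie fmempty) = S" by (simp add: paths.simps)
  then show ?case by blast
next
  case (Suc n)
  show ?case
  proof (cases "[] \<in> S")
    case True
    then have "S = {[]}" using Suc.prems(3)[of "[]"] by auto
    then have "paths (Trie fmempty) = S" by (simp add: paths.simps)
    then show ?thesis by blast
  next
    case False
    have "\<exists>t. paths t = {w. a # w \<in> S}" if "a \<in> hd ` S" for a
    proof (rule Suc.IH)
      have "{w. a # w \<in> S} = (\<lambda>w. a # w) -` S" by auto
      then show "finite {w. a # w \<in> S}"
        using Suc.prems(1) by (simp add: finite_vimageI)
      from that obtain u where "u \<in> S" "a = hd u" by auto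
      with False have "a # tl u \<in> S" by (cases u) auto
      then show "{w. a # w \<in> S} \<noteq> {}" by auto
    next
      fix u v assume "u \<in> {w. a # w \<in> S}" "v \<in> {w. a # w \<in> S}" "prefix u v"
      then show "u = v" using Suc.prems(3)[of "a # u" "a # v"] by simp
    next
      fix u assume "u \<in> {w. a # w \<in> S}"
      then show "length u \<le> n" using Suc.prems(4)[of "a # u"] by simp
    qed
    then obtain f where f: "\<And>a. a \<in> hd ` S \<Longrightarrow> paths (f a) = {w. a # w \<in> S}"
      by metis
    obtain as where as: "set as = hd ` S"
      using finite_list[OF finite_imageI[OF Suc.prems(1)]] by metis
    define m where "m = fmap_of_list (map (\<lambda>a. (a, f a)) as)"
    have m: "fmlookup m a = (if a \<in> hd ` S then Some (f a) else None)" for a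
      by (simp add: m_def fmlookup_of_list map_of_map_restrict as)
    obtain u where "u \<in> S" using Suc.prems(2) by blast
    then have "fmlookup m (hd u) \<noteq> None" by (simp add: m)
    then have "m \<noteq> fmempty" by auto
    have "w \<in> paths (Trie m) \<longleftrightarrow> w \<in> S" for w
    proof (cases w)
      case Nil
      then show ?thesis using False \<open>m \<noteq> fmempty\<close> by (simp add: paths.simps)
    next
      case (Cons a v)
      have "a # v \<in> paths (Trie m) \<longleftrightarrow> a \<in> hd ` S \<and> v \<in> paths (f a)"
        by (auto simp: Cons_in_paths_iff m split: if_splits)
      also have "\<dots> \<longleftrightarrow> a # v \<in> S"
      proof (cases "a \<in> hd ` S")
        case True
        then show ?thesis by (simp add: f)
      next
        case False
        then have "a # v \<notin> S" by (metis imageI list.sel(1))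
        with False show ?thesis by simp
      qed
      finally show ?thesis by (simp add: Cons)
    qed
    then show ?thesis by blast
  qed
qed

lemma paths_palindrome_trie:
  assumes PS: "palindromic_set sem PS" and ne: "PS \<noteq> {}"
  shows "paths (palindrome_trie PS) = (\<lambda>c. arm c @ [middle c]) ` PS"
proof -
  let ?S = "(\<lambda>c. arm c @ [middle c]) ` PS"
  have fin: "finite ?S" using PS by (simp add: palindromic_set_def)
  have pre: "u = v" if uv: "u \<in> ?S" "v \<in> ?S" "prefix u v" for u v
  proof -
    from uv obtain c d where c: "c \<in> PS" "u = arm c @ [middle c]"
      and d: "d \<in> PS" "v = arm d @ [middle d]" by auto
    have "middle c \<in> set v"
      using uv(3) c(2) by (auto dest: set_mono_prefix)
    moreover have "middle c \<notin> set (arm d)"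
      using PS c d by (auto simp: palindromic_set_def)
    ultimately have "middle c = middle d" using d by auto
    then have "c = d" using PS c d by (auto simp: palindromic_set_def dest: inj_onD)
    then show ?thesis using c d by simp
  qed
  have "\<exists>t. paths t = ?S"
    using ex_trie[OF fin _ pre, of "Max (length ` ?S)"] fin ne by simp
  then have "\<exists>!t. paths t = ?S"
    using paths_inject by metis
  then show ?thesis unfolding palindrome_trie_def by (rule theI')
qed

end

(*
  The length of the longest common prefix of two strings counts their nonempty common prefixes p,
  so the total overlap of an ordering is the sum, over the nodes p of the trie, of the number of
  adjacent pairs of strings that both lie below p. If n strings lie below p, at most n - 1 adjacent
  pairs do, with equality iff these n strings are contiguous in the ordering. The orderings in which
  the strings below every node are contiguous are exactly those of mos; as there is one, all the
  bounds are attained simultaneously, and precisely by the members of mos.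
*)
theory Submission imports Defs
begin

subsection \<open>Contiguous elements of a list\<close>

fun contiguous :: "('a \<Rightarrow> bool) \<Rightarrow> 'a list \<Rightarrow> bool" where
  "contiguous P [] \<longleftrightarrow> True"
| "contiguous P (x # xs) \<longleftrightarrow>
     (if P x then filter P (dropWhile P xs) = [] else contiguous P xs)"

fun adjacent :: "('a \<Rightarrow> bool) \<Rightarrow> 'a list \<Rightarrow> nat" where
  "adjacent P (x # y # zs) = of_bool (P x \<and> P y) + adjacent P (y # zs)"
| "adjacent P _ = 0"

text \<open>If n elements satisfy \<open>P\<close> and form r maximal runs, they give n - r adjacent
  pairs, and r \<ge> 1 unless n = 0. For n = 0 the truncated subtraction yields the correct bound
  0.\<close>

lemma adjacent_le: "adjacent P xs \<le> length (filter P xs) - 1"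
  by (induction P xs rule: adjacent.induct) (auto split: if_splits)

text \<open>Equality means that there is at most one run. Contiguity thereby becomes tightness of a
  numerical bound, and such bounds can be summed over the nodes.\<close>

lemma contiguous_iff_adjacent: "contiguous P xs \<longleftrightarrow> adjacent P xs = length (filter P xs) - 1"
proof (induction P xs rule: adjacent.induct)
  case (1 P x y zs)
  have le: "adjacent P (y # zs) \<le> length (filter P (y # zs)) - 1" by (rule adjacent_le)
  show ?case
  proof (cases "P x \<and> \<not> P y")
    case True
    then have "contiguous P (x # y # zs) \<longleftrightarrow> filter P zs = []" by (simp add: filter_empty_conv)
    also have "\<dots> \<longleftrightarrow> length (filter P zs) = 0" by simp
    \<comment> \<open>As \<open>y\<close> does not satisfy \<open>P\<close>, \<open>le\<close>
      bounds the left side by the right side minus one, truncated; they can agree only at 0.\<close>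
    also have "\<dots> \<longleftrightarrow> adjacent P (y # zs) = length (filter P zs)"
      using le True by (simp del: length_0_conv) linarith
    finally show ?thesis using True by simp
  next
    case False
    with "1.IH" show ?thesis by (cases "P y") auto
  qed
qed auto

section \<open>Stability of contiguity under deletion, mapping and concatenation\<close>

lemma contiguous_if_none: "filter P xs = [] \<Longrightarrow> contiguous P xs"
  by (induction xs) (auto split: if_splits)

lemma contiguous_if_filter_dropWhile: "filter P (dropWhile P xs) = [] \<Longrightarrow> contiguous P xs"
  by (induction xs) (auto split: if_splits intro: contiguous_if_none)

lemma contiguous_if_all: "\<forall>x\<in>set xs. P x \<Longrightarrow> contiguous P xs"
  by (rule contiguous_if_filter_dropWhile) (metis dropWhile_eq_Nil_conv filter.simps(1))

lemma filter_dropWhile_filter: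
  "filter P (dropWhile P xs) = [] \<Longrightarrow> filter P (dropWhile P (filter Q xs)) = []"
proof (induction xs)
  case (Cons x xs)
  show ?case
  proof (cases "P x")
    case False
    with Cons.prems have "\<forall>y\<in>set xs. \<not> P y" by (simp add: filter_empty_conv)
    with False show ?thesis by (auto simp: filter_empty_conv dest: set_dropWhileD)
  qed (use Cons in simp)
qed simp

text \<open>Deletion creates no gap inside the run. If it removes the first element of the run, the
  rest begins with a possibly empty run after which nothing satisfies \<open>P\<close>.\<close>

lemma contiguous_filter: "contiguous P xs \<Longrightarrow> contiguous P (filter Q xs)"
  by (induction xs)
    (auto split: if_splits intro: contiguous_if_filter_dropWhile filter_dropWhile_filter)

lemma contiguous_map: "contiguous P (map f xs) \<longleftrightarrow> contiguous (P \<circ> f) xs"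
  by (induction xs) (auto simp: dropWhile_map filter_map comp_def)

lemma contiguous_cong:
  "(\<And>x. x \<in> set xs \<Longrightarrow> P x = Q x) \<Longrightarrow> contiguous P xs \<longleftrightarrow> contiguous Q xs"
proof (induction xs)
  case (Cons x xs)
  have "dropWhile P xs = dropWhile Q xs" by (rule dropWhile_cong) (simp_all add: Cons.prems)
  moreover have "filter P (dropWhile Q xs) = filter Q (dropWhile Q xs)"
    by (rule filter_cong) (auto simp: Cons.prems dest: set_dropWhileD)
  ultimately show ?case using Cons by simp
qed simp

lemma contiguous_append_left:
  "filter P us = [] \<Longrightarrow> contiguous P (us @ vs) \<longleftrightarrow> contiguous P vs"
  by (induction us) (auto split: if_splits)

lemma filter_dropWhile_append:
  "filter P (dropWhile P us) = [] \<Longrightarrow> filter P vs = [] \<Longrightarrow> filter P (dropWhile P (us @ vs)) = []"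
proof (induction us)
  case Nil
  then show ?case by (auto simp: filter_empty_conv dest: set_dropWhileD)
next
  case (Cons u us)
  then show ?case by (cases "P u") simp_all
qed

lemma contiguous_append_right:
  "filter P vs = [] \<Longrightarrow> contiguous P us \<Longrightarrow> contiguous P (us @ vs)"
  by (induction us) (auto simp: filter_dropWhile_append contiguous_if_none split: if_splits)

text \<open>By the last hypothesis, all elements satisfying \<open>P\<close> lie in a single block,
  so contiguity has to be checked only there.\<close>

lemma contiguous_concat:
  assumes "distinct as" "\<And>a. a \<in> set as \<Longrightarrow> contiguous P (f a)"
    and "\<And>a b x y. a \<in> set as \<Longrightarrow> b \<in> set as \<Longrightarrow> x \<in> set (f a) \<Longrightarrow> y \<in> set (f b) \<Longrightarrow>
      P x \<Longrightarrow> P y \<Longrightarrow> a = b"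
  shows "contiguous P (concat (map f as))"
  using assms
proof (induction as)
  case (Cons a as)
  have IH: "contiguous P (concat (map f as))"
    by (rule Cons.IH) (use Cons.prems in auto)
  show ?case
  proof (cases "\<exists>x\<in>set (f a). P x")
    case True
    then have "\<forall>y\<in>set (concat (map f as)). \<not> P y"
      using Cons.prems(1,3) by fastforce
    then have "filter P (concat (map f as)) = []" by (simp only: filter_empty_conv)
    then show ?thesis using Cons.prems(2) by (simp add: contiguous_append_right)
  next
    case False
    then have "filter P (f a) = []" by (simp add: filter_empty_conv)
    then show ?thesis using IH by (simp add: contiguous_append_left)
  qed
qed simp

text \<open>The list runs through the fibers of \<open>f\<close> one after another, and
  \<open>as\<close> records the values in order of first occurrence. With \<open>hd\<close> for
  \<open>f\<close> this recovers the order in which the children of the root are visited.\<close>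

lemma concat_of_contiguous_fibers:
  assumes "\<And>a. contiguous (\<lambda>x. f x = a) xs"
  shows "\<exists>as. distinct as \<and> set as = f ` set xs \<and>
    xs = concat (map (\<lambda>a. filter (\<lambda>x. f x = a) xs) as)"
  using assms
proof (induction xs rule: length_induct)
  case (1 xs)
  show ?case
  proof (cases xs)
    case Nil
    then show ?thesis by simp
  next
    case (Cons x xs')
    define us where "us = x # takeWhile (\<lambda>y. f y = f x) xs'"
    define vs where "vs = dropWhile (\<lambda>y. f y = f x) xs'"
    have xs: "xs = us @ vs" by (simp add: Cons us_def vs_def)
    have us: "f y = f x" if "y \<in> set us" for y
      using that by (auto simp: us_def dest: set_takeWhileD)
    have vs: "f y \<noteq> f x" if "y \<in> set vs" for y
    proof -
      have "filter (\<lambda>y. f y = f x) vs = []"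
        using "1.prems"[of "f x"] by (simp add: Cons vs_def)
      then show ?thesis using that by (simp add: filter_empty_conv)
    qed
    \<comment> \<open>The leading run \<open>us\<close> is a whole fiber. As a filtered list, the
      remainder inherits the contiguity of all fibers, which the induction hypothesis
      requires.\<close>
    have "vs = filter (\<lambda>y. f y \<noteq> f x) xs"
      using us vs by (simp add: xs filter_empty_conv filter_id_conv)
    then have "contiguous (\<lambda>x. f x = a) vs" for a
      using "1.prems" contiguous_filter by metis
    moreover have "length vs < length xs" by (simp add: xs us_def)
    ultimately obtain as where as: "distinct as" "set as = f ` set vs"
      "vs = concat (map (\<lambda>a. filter (\<lambda>x. f x = a) vs) as)"
      using "1.IH" by blast
    have "filter (\<lambda>y. f y = a) xs = filter (\<lambda>y. f y = a) vs" if "a \<in> set as" for a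
    proof -
      have "a \<noteq> f x" using that vs as(2) by auto
      then show ?thesis using us by (auto simp: xs filter_empty_conv)
    qed
    then have map: "map (\<lambda>a. filter (\<lambda>y. f y = a) xs) as = map (\<lambda>a. filter (\<lambda>y. f y = a) vs) as"
      by simp
    have "filter (\<lambda>y. f y = f x) xs = us"
      using us vs by (simp add: xs filter_empty_conv filter_id_conv)
    then have "concat (map (\<lambda>a. filter (\<lambda>y. f y = a) xs) (f x # as)) =
        us @ concat (map (\<lambda>a. filter (\<lambda>y. f y = a) vs) as)"
      by (simp only: list.map concat.simps map)
    also have "\<dots> = xs" by (simp only: as(3)[symmetric] xs)
    finally have "xs = concat (map (\<lambda>a. filter (\<lambda>y. f y = a) xs) (f x # as))" by (rule sym)
    moreover have "f x \<notin> f ` set vs"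
    proof
      assume "f x \<in> f ` set vs"
      then obtain y where "f x = f y" "y \<in> set vs" by (rule imageE)
      then show False using vs by metis
    qed
    then have "distinct (f x # as)" using as(1) by (simp add: as(2))
    moreover have "set (f x # as) = f ` set xs"
    proof -
      have "x \<in> set us" by (simp add: us_def)
      with us have "f ` set us = {f x}" by blast
      then show ?thesis by (simp add: as(2) xs image_Un)
    qed
    ultimately show ?thesis by blast
  qed
qed

subsection \<open>The sequences of \<open>mos\<close> as orderings of the paths\<close>

text \<open>Here \<open>p\<close> ranges over all strings, so no trie is mentioned; a string that is
  a prefix of no member of \<open>ws\<close> imposes no condition.\<close>

definition nodewise_contiguous :: "'g list list \<Rightarrow> bool" where
  "nodewise_contiguous ws \<longleftrightarrow> (\<forall>p. contiguous (prefix p) ws)"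

lemma contiguous_prefix_Nil: "contiguous (prefix []) ws"
  by (simp add: contiguous_if_all)

text \<open>Since the child labels are distinct, the block chosen for a child can be indexed by its
  label instead of by its position.\<close>

lemma list_all2_distinct_map:
  assumes "list_all2 R xs ys" "distinct xs"
  shows "\<exists>h. ys = map h xs \<and> (\<forall>x\<in>set xs. R x (h x))"
  using assms
proof (induction rule: list_all2_induct)
  case (Cons x xs y ys)
  then obtain h where "ys = map h xs" "\<forall>x\<in>set xs. R x (h x)" by auto
  with Cons show ?case by (intro exI[of _ "h(x := y)"]) auto
qed simp

section \<open>Members of \<open>mos\<close> as concatenations of blocks indexed by the
  children\<close>

lemma Nil_in_paths_iff: "[] \<in> paths t \<longleftrightarrow> t = Trie fmempty"
  by (cases t) (simp add: paths.simps)

lemma mos_Trie_iff: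
  "xs \<in> mos (Trie m) \<longleftrightarrow> (\<exists>as\<in>permutations_of_set (fmdom' m). \<exists>h. xs = concat (map h as) \<and>
     (\<forall>a\<in>set as. \<exists>t. fmlookup m a = Some t \<and>
       (if card (paths t) = 1 then h a \<in> {[last (a # w)] |w. w \<in> paths t} else h a \<in> mos t)))"
    (is "_ \<longleftrightarrow> (\<exists>as\<in>_. \<exists>h. _ \<and> (\<forall>a\<in>set as. ?R a (h a)))")
proof
  assume "xs \<in> mos (Trie m)"
  then obtain as bs where *: "xs = concat bs" "as \<in> permutations_of_set (fmdom' m)"
    "list_all2 ?R as bs"
    unfolding mos.simps by blast
  then have "distinct as" by (simp add: permutations_of_set_def)
  then obtain h where "bs = map h as" "\<forall>a\<in>set as. ?R a (h a)"
    using list_all2_distinct_map[OF *(3)] by blast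
  with * show "\<exists>as\<in>permutations_of_set (fmdom' m). \<exists>h. xs = concat (map h as) \<and>
    (\<forall>a\<in>set as. ?R a (h a))" by blast
next
  assume "\<exists>as\<in>permutations_of_set (fmdom' m). \<exists>h. xs = concat (map h as) \<and>
    (\<forall>a\<in>set as. ?R a (h a))"
  then obtain as h where *: "as \<in> permutations_of_set (fmdom' m)" "xs = concat (map h as)"
    "\<forall>a\<in>set as. ?R a (h a)" by blast
  then have "list_all2 ?R as (map h as)"
    by (simp only: list_all2_map2 list_all2_same)
  with * show "xs \<in> mos (Trie m)" unfolding mos.simps by blast
qed

text \<open>Needed to know that the upper bound on the total overlap is attained by some
  ordering.\<close>

lemma mos_nonempty: "mos t \<noteq> {}"
proof (induction t)
  case (Trie m)
  define ok where "ok a b \<longleftrightarrow> (\<exists>t. fmlookup m a = Some t \<and>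
    (if card (paths t) = 1 then b \<in> {[last (a # w)] |w. w \<in> paths t} else b \<in> mos t))" for a b
  have "\<exists>b. ok a b" if a: "a \<in> fmdom' m" for a
  proof -
    from a obtain t where t: "fmlookup m a = Some t" by (auto simp: fmlookup_dom'_iff)
    have "mos t \<noteq> {}" by (rule Trie.IH[OF fmran'I[OF t]])
    then obtain b where "b \<in> mos t" by blast
    moreover obtain w where "w \<in> paths t" using paths_nonempty by blast
    ultimately have "ok a (if card (paths t) = 1 then [last (a # w)] else b)"
      using t by (auto simp: ok_def)
    then show ?thesis by (rule exI)
  qed
  then obtain h where h: "\<And>a. a \<in> fmdom' m \<Longrightarrow> ok a (h a)" by metis
  have "permutations_of_set (fmdom' m) \<noteq> {}" by simp
  then obtain as where as: "as \<in> permutations_of_set (fmdom' m)" by blast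
  then have "\<forall>a\<in>set as. ok a (h a)" using h by (simp add: permutations_of_set_def)
  with as have "concat (map h as) \<in> mos (Trie m)"
    unfolding mos_Trie_iff ok_def by blast
  then show ?case by blast
qed

text \<open>Strings with prefix \<open>b # q\<close> occur only in the block of \<open>b\<close>,
  where the condition reduces to \<open>q\<close> on the tails.\<close>

lemma nodewise_contiguous_concat_Cons:
  assumes "distinct as" "\<And>a. a \<in> set as \<Longrightarrow> nodewise_contiguous (vs a)"
  shows "nodewise_contiguous (concat (map (\<lambda>a. map ((#) a) (vs a)) as))"
  unfolding nodewise_contiguous_def
proof
  fix p
  show "contiguous (prefix p) (concat (map (\<lambda>a. map ((#) a) (vs a)) as))"
  proof (cases p)
    case Nil
    then show ?thesis by (simp add: contiguous_prefix_Nil)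
  next
    case (Cons b q)
    show ?thesis
    proof (rule contiguous_concat[OF assms(1)])
      fix a assume "a \<in> set as"
      then have "contiguous (prefix q) (vs a)"
        using assms(2) by (simp add: nodewise_contiguous_def)
      then show "contiguous (prefix p) (map ((#) a) (vs a))"
        by (cases "a = b")
          (auto simp: Cons contiguous_map comp_def filter_empty_conv intro: contiguous_if_none)
    qed (auto simp: Cons)
  qed
qed

text \<open>The one-letter prefixes make the fibers of \<open>hd\<close> contiguous and so split
  \<open>ws\<close> into blocks; the prefixes \<open>a # p\<close> give nodewise contiguity of the
  tails in the block of \<open>a\<close>.\<close>

lemma nodewise_contiguous_split:
  assumes nc: "nodewise_contiguous ws" and "[] \<notin> set ws"
  shows "\<exists>as. distinct as \<and> set as = hd ` set ws \<and>
    ws = concat (map (\<lambda>a. map ((#) a) (map tl (filter (\<lambda>w. hd w = a) ws))) as) \<and>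
    (\<forall>a. nodewise_contiguous (map tl (filter (\<lambda>w. hd w = a) ws)))"
proof -
  have hd: "prefix (a # p) w \<longleftrightarrow> hd w = a \<and> prefix p (tl w)" if "w \<in> set ws" for a p w
  proof -
    have "w \<noteq> []" using that assms(2) by metis
    then show ?thesis by (cases w) auto
  qed
  have "contiguous (\<lambda>w. hd w = a) ws" for a
  proof -
    have "contiguous (prefix [a]) ws" using nc by (simp add: nodewise_contiguous_def)
    then show ?thesis by (rule contiguous_cong[THEN iffD1, rotated]) (simp add: hd)
  qed
  then obtain as where as: "distinct as" "set as = hd ` set ws"
    "ws = concat (map (\<lambda>a. filter (\<lambda>w. hd w = a) ws) as)"
    using concat_of_contiguous_fibers by blast
  have "map ((#) a) (map tl (filter (\<lambda>w. hd w = a) ws)) = filter (\<lambda>w. hd w = a) ws" for a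
    unfolding map_map
  proof (rule map_idI)
    fix w assume "w \<in> set (filter (\<lambda>w. hd w = a) ws)"
    then have "hd w = a" "w \<noteq> []" using assms(2) by auto
    then show "((#) a \<circ> tl) w = w" by (cases w) auto
  qed
  with as(3) have "ws = concat (map (\<lambda>a. map ((#) a) (map tl (filter (\<lambda>w. hd w = a) ws))) as)"
    by (simp only:)
  moreover have "nodewise_contiguous (map tl (filter (\<lambda>w. hd w = a) ws))" for a
    unfolding nodewise_contiguous_def contiguous_map
  proof
    fix p
    have "contiguous (prefix (a # p)) (filter (\<lambda>w. hd w = a) ws)"
      using nc by (intro contiguous_filter) (simp add: nodewise_contiguous_def)
    then show "contiguous (prefix p \<circ> tl) (filter (\<lambda>w. hd w = a) ws)"
      by (rule contiguous_cong[THEN iffD1, rotated]) (simp add: hd)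
  qed
  ultimately show ?thesis using as(1,2) by blast
qed

text \<open>Induction on the trie, with blocks matched to children. The bare root is excluded:
  \<open>mos\<close> assigns it only the empty sequence, but its single path \<open>[]\<close> would
  yield a one-term sequence on the right.\<close>

lemma mos_eq_nodewise_contiguous:
  assumes "t \<noteq> Trie fmempty"
  shows "mos t = {map last ws |ws. ws \<in> permutations_of_set (paths t) \<and> nodewise_contiguous ws}"
  using assms
proof (induction t)
  case (Trie m)
  define good where
    "good t = {vs. vs \<in> permutations_of_set (paths t) \<and> nodewise_contiguous vs}" for t :: "'a trie"
  \<comment> \<open>Both cases of the recursion become orderings of the paths of the child. The
    label \<open>a\<close> is kept in front because \<open>w\<close> is empty if the child is a
    leaf; with more than one path, no \<open>w\<close> is empty and the induction hypothesis
    applies.\<close>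
  have block: "(if card (paths t) = 1 then b \<in> {[last (a # w)] |w. w \<in> paths t} else b \<in> mos t)
      \<longleftrightarrow> (\<exists>vs\<in>good t. b = map (\<lambda>w. last (a # w)) vs)"
    if t: "fmlookup m a = Some t" for a b t
  proof (cases "card (paths t) = 1")
    case True
    then obtain w where w: "paths t = {w}" by (auto simp: card_1_singleton_iff)
    have "nodewise_contiguous [w]" by (simp add: nodewise_contiguous_def)
    then have "good t = {[w]}"
      unfolding good_def w permutations_of_set_singleton by blast
    with w show ?thesis by simp
  next
    case False
    then have ne: "t \<noteq> Trie fmempty" by (auto simp: paths.simps)
    have last: "map (\<lambda>w. last (a # w)) vs = map last vs" if "vs \<in> good t" for vs
      using that ne Nil_in_paths_iff[of t] by (auto simp: good_def permutations_of_set_def)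
    have "mos t = map last ` good t"
      using Trie.IH[of t] t ne by (auto simp: good_def intro: fmran'I)
    then have "b \<in> mos t \<longleftrightarrow> (\<exists>vs\<in>good t. b = map last vs)" by auto
    also have "\<dots> \<longleftrightarrow> (\<exists>vs\<in>good t. b = map (\<lambda>w. last (a # w)) vs)"
      by (rule bex_cong[OF refl]) (simp only: last)
    finally show ?thesis unfolding if_not_P[OF False] .
  qed
  have "(\<exists>t. fmlookup m a = Some t \<and>
      (if card (paths t) = 1 then b \<in> {[last (a # w)] |w. w \<in> paths t} else b \<in> mos t)) \<longleftrightarrow>
      (\<exists>t. fmlookup m a = Some t \<and> (\<exists>vs\<in>good t. b = map (\<lambda>w. last (a # w)) vs))" for a b
    by (rule ex_cong1, rule conj_cong, rule refl, rule block)
  note mos_iff = mos_Trie_iff[of _ m, unfolded this]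
  have paths: "w \<in> paths (Trie m) \<longleftrightarrow>
      (\<exists>a v. w = a # v \<and> a \<in> fmdom' m \<and> v \<in> paths (the (fmlookup m a)))" for w
    using Trie.prems
    by (cases w) (auto simp: Nil_in_paths_iff Cons_in_paths_iff fmlookup_dom'_iff)
  show ?case
  proof (intro equalityI subsetI)
    fix xs assume "xs \<in> mos (Trie m)"
    then obtain as h where as: "as \<in> permutations_of_set (fmdom' m)" and xs: "xs = concat (map h as)"
      and h: "\<forall>a\<in>set as. \<exists>t. fmlookup m a = Some t \<and> (\<exists>vs\<in>good t. h a = map (\<lambda>w. last (a # w)) vs)"
      unfolding mos_iff by blast
    from h have "\<forall>a\<in>set as. \<exists>vs\<in>good (the (fmlookup m a)). h a = map (\<lambda>w. last (a # w)) vs"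
      by force
    then obtain vs where vs: "\<And>a. a \<in> set as \<Longrightarrow> vs a \<in> good (the (fmlookup m a))"
      "\<And>a. a \<in> set as \<Longrightarrow> h a = map (\<lambda>w. last (a # w)) (vs a)" by metis
    \<comment> \<open>Each path of a child, extended by the label of the child, is a path of the
      whole trie.\<close>
    define ws where "ws = concat (map (\<lambda>a. map ((#) a) (vs a)) as)"
    have das: "distinct as" "set as = fmdom' m" using as by (auto simp: permutations_of_set_def)
    have set_vs: "set (vs a) = paths (the (fmlookup m a))" if "a \<in> fmdom' m" for a
      using vs(1)[of a] that das(2) by (simp add: good_def permutations_of_set_def)
    have "set ws = (\<Union>a\<in>fmdom' m. (#) a ` paths (the (fmlookup m a)))"
      using set_vs by (simp add: ws_def das(2))
    also have "\<dots> = paths (Trie m)"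
      unfolding set_eq_iff paths by blast
    finally have "set ws = paths (Trie m)" .
    moreover have "distinct ws"
      using das(1) vs(1) unfolding ws_def
    proof (induction as)
      case (Cons a as)
      then show ?case
        by (auto simp: good_def permutations_of_set_def distinct_map)
    qed simp
    moreover have "nodewise_contiguous ws"
      unfolding ws_def using vs(1) das(1)
      by (intro nodewise_contiguous_concat_Cons) (auto simp: good_def)
    moreover have "xs = map last ws"
      unfolding xs ws_def map_concat map_map
      by (rule arg_cong[where f = concat], rule map_cong) (auto simp: vs(2))
    ultimately show "xs \<in> {map last ws |ws. ws \<in> permutations_of_set (paths (Trie m)) \<and>
      nodewise_contiguous ws}"
      by (auto simp: permutations_of_set_def)
  next
    fix xs assume "xs \<in> {map last ws |ws. ws \<in> permutations_of_set (paths (Trie m)) \<and>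
      nodewise_contiguous ws}"
    then obtain ws where xs: "xs = map last ws" and ws: "set ws = paths (Trie m)" "distinct ws"
      and nc: "nodewise_contiguous ws"
      by (auto simp: permutations_of_set_def)
    have ne: "[] \<notin> set ws" using ws Trie.prems by (simp add: Nil_in_paths_iff)
    define vs where "vs a = map tl (filter (\<lambda>w. hd w = a) ws)" for a
    obtain as where as: "distinct as" "set as = hd ` set ws"
      "ws = concat (map (\<lambda>a. map ((#) a) (vs a)) as)" "\<And>a. nodewise_contiguous (vs a)"
      using nodewise_contiguous_split[OF nc ne] unfolding vs_def by blast
    have "hd ` set ws = fmdom' m"
    proof (intro equalityI subsetI)
      fix a assume a: "a \<in> fmdom' m"
      obtain v where "v \<in> paths (the (fmlookup m a))" using paths_nonempty by blast
      with a have "a # v \<in> set ws" using ws(1) paths by blast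
      then show "a \<in> hd ` set ws" by force
    qed (use ws(1) paths in auto)
    with as have as': "as \<in> permutations_of_set (fmdom' m)" by (simp add: permutations_of_set_def)
    have "vs a \<in> good t" if t: "fmlookup m a = Some t" for a t
    proof -
      have "set (vs a) = paths t"
      proof (intro equalityI subsetI)
        fix v assume "v \<in> paths t"
        then have "a # v \<in> set ws" using t ws(1) by (auto simp: Cons_in_paths_iff)
        then show "v \<in> set (vs a)" by (force simp: vs_def)
      qed (use ws(1) paths t in \<open>auto simp: vs_def\<close>)
      \<comment> \<open>Nonempty strings with the same head are determined by their tails.\<close>
      moreover have "distinct (vs a)"
        unfolding vs_def distinct_map using ws(2) ne
        by (auto intro!: inj_onI) (metis list.collapse)
      ultimately show ?thesis using as(4) by (simp add: good_def permutations_of_set_def)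
    qed
    moreover have "\<exists>t. fmlookup m a = Some t" if "a \<in> set as" for a
      using that as' by (auto simp: permutations_of_set_def fmlookup_dom'_iff)
    ultimately have "\<forall>a\<in>set as. \<exists>t. fmlookup m a = Some t \<and>
        (\<exists>us\<in>good t. map (\<lambda>w. last (a # w)) (vs a) = map (\<lambda>w. last (a # w)) us)"
      by blast
    moreover have "xs = concat (map (\<lambda>a. map (\<lambda>w. last (a # w)) (vs a)) as)"
      unfolding xs by (subst as(3)) (simp add: map_concat comp_def)
    ultimately show "xs \<in> mos (Trie m)"
      unfolding mos_iff using as' by blast
  qed
qed

subsection \<open>Counting overlaps by trie nodes\<close>

text \<open>The common prefixes of \<open>u\<close> and \<open>v\<close> are exactly the prefixes of
  the longest one, and a string of length n has n nonempty prefixes.\<close>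

lemma length_overlap:
  "length (overlap (rev u) v) = card {p. p \<noteq> [] \<and> prefix p u \<and> prefix p v}"
proof -
  let ?P = "\<lambda>p. prefix p v \<and> suffix (rev p) (rev u)"
  have P: "?P p \<longleftrightarrow> prefix p v \<and> prefix p u" for p by (simp add: suffix_to_prefix)
  have "?P []" by simp
  moreover have "\<forall>p. ?P p \<longrightarrow> length p < Suc (length v)"
    by (auto dest: prefix_length_le)
  ultimately have ov: "?P (overlap (rev u) v)" "\<And>p. ?P p \<Longrightarrow> length p \<le> length (overlap (rev u) v)"
    unfolding overlap_def
    using arg_max_nat_lemma[of ?P "[]" length "Suc (length v)"] by blast+
  have "prefix p u \<and> prefix p v \<longleftrightarrow> prefix p (overlap (rev u) v)" for p
    using ov P by (metis prefix_length_prefix prefix_order.trans)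
  then have "{p. p \<noteq> [] \<and> prefix p u \<and> prefix p v} = set (prefixes (overlap (rev u) v)) - {[]}"
    by auto
  also have "card \<dots> = length (overlap (rev u) v)"
    by (subst card_Diff_singleton) (auto simp: distinct_card)
  finally show ?thesis by simp
qed

section \<open>The total overlap as a sum over trie nodes, and its upper bound\<close>

lemma total_overlap_Cons_Cons:
  "total_overlap (c # d # cs) = length (overlap (rev (arm c)) (arm d)) + total_overlap (d # cs)"
  by (simp add: total_overlap_def sum.lessThan_Suc_shift del: sum.lessThan_Suc)

text \<open>The root-to-leaf path that represents \<open>c\<close> in the palindrome trie.\<close>

definition gate_string :: "'g list \<Rightarrow> 'g list" where
  "gate_string c = arm c @ [middle c]"

lemma last_gate_string: "last (gate_string c) = middle c"
  by (simp add: gate_string_def)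

text \<open>The non-root nodes of the trie, each identified with the string spelled on the way to
  it. The root is left out because the empty prefix adds nothing to the length of an
  overlap.\<close>

definition nodes :: "'g list set \<Rightarrow> 'g list set" where
  "nodes PS = {p. p \<noteq> [] \<and> (\<exists>c\<in>PS. prefix p (gate_string c))}"

lemma finite_nodes: "finite PS \<Longrightarrow> finite (nodes PS)"
  by (rule finite_subset[of _ "\<Union>c\<in>PS. set (prefixes (gate_string c))"]) (auto simp: nodes_def)

lemma inj_on_gate_string: "palindromic_set sem PS \<Longrightarrow> inj_on gate_string PS"
  by (auto simp: palindromic_set_def inj_on_def gate_string_def)

text \<open>Overlaps compare arms, whereas the trie stores arms followed by middle gates. As the
  middle gates are distinct and occur in no arm, appending them creates no new common
  prefix.\<close>

lemma prefix_gate_strings_iff: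
  assumes PS: "palindromic_set sem PS" and cd: "c \<in> PS" "d \<in> PS" "c \<noteq> d"
  shows "prefix p (gate_string c) \<and> prefix p (gate_string d) \<longleftrightarrow> prefix p (arm c) \<and> prefix p (arm d)"
proof -
  have "middle c \<noteq> middle d" "middle c \<notin> set (arm d)" "middle d \<notin> set (arm c)"
    using assms by (auto simp: palindromic_set_def dest: inj_onD)
  then show ?thesis
    by (auto simp: gate_string_def prefix_snoc dest: set_mono_prefix)
qed

text \<open>Double counting of the pairs formed by a node and two consecutive strings below it.
  Allowing \<open>cs\<close> to cover only part of \<open>PS\<close> lets the induction pass to the
  tail.\<close>

lemma total_overlap_eq_sum_nodes:
  assumes PS: "palindromic_set sem PS" and "set cs \<subseteq> PS" "distinct cs"
  shows "total_overlap cs = (\<Sum>p\<in>nodes PS. adjacent (prefix p) (map gate_string cs))"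
  using assms(2,3)
proof (induction cs rule: induct_list012)
  case (3 c d cs)
  have fin: "finite (nodes PS)" using PS by (simp add: palindromic_set_def finite_nodes)
  have "{p. p \<noteq> [] \<and> prefix p (arm c) \<and> prefix p (arm d)} =
      {p \<in> nodes PS. prefix p (gate_string c) \<and> prefix p (gate_string d)}"
    using prefix_gate_strings_iff[OF PS, of c d] 3(3,4) by (auto simp: nodes_def)
  then have "length (overlap (rev (arm c)) (arm d)) =
      (\<Sum>p\<in>nodes PS. of_bool (prefix p (gate_string c) \<and> prefix p (gate_string d)))"
    using fin by (simp add: length_overlap sum_of_bool_eq Int_def)
  with 3 show ?case by (simp add: total_overlap_Cons_Cons sum.distrib)
qed (simp_all add: total_overlap_def)

text \<open>Independent of any ordering. Every node lies above at least one string, so the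
  subtraction never truncates.\<close>

definition overlap_bound :: "'g list set \<Rightarrow> nat" where
  "overlap_bound PS = (\<Sum>p\<in>nodes PS. card {w \<in> gate_string ` PS. prefix p w} - 1)"

lemma total_overlap_bound:
  assumes PS: "palindromic_set sem PS" and cs: "cs \<in> permutations_of_set PS"
  shows "total_overlap cs \<le> overlap_bound PS"
    and "total_overlap cs = overlap_bound PS \<longleftrightarrow> nodewise_contiguous (map gate_string cs)"
proof -
  let ?ws = "map gate_string cs"
  have cs': "set cs = PS" "distinct cs" using cs by (auto simp: permutations_of_set_def)
  have fin: "finite (nodes PS)" using PS by (simp add: palindromic_set_def finite_nodes)
  have "distinct ?ws" using inj_on_gate_string[OF PS] cs' by (simp add: distinct_map)
  then have len: "card {w \<in> gate_string ` PS. prefix p w} = length (filter (prefix p) ?ws)" for p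
    using distinct_card[of "filter (prefix p) ?ws"] cs'(1) by auto
  have total: "total_overlap cs = (\<Sum>p\<in>nodes PS. adjacent (prefix p) ?ws)"
    using total_overlap_eq_sum_nodes[OF PS] cs' by blast
  show le: "total_overlap cs \<le> overlap_bound PS"
    unfolding total overlap_bound_def len by (intro sum_mono adjacent_le)
  have "nodewise_contiguous ?ws \<longleftrightarrow> (\<forall>p\<in>nodes PS. contiguous (prefix p) ?ws)"
  proof -
    have "contiguous (prefix p) ?ws" if "p \<notin> nodes PS" for p
    proof (cases "p = []")
      case True
      then show ?thesis by (simp add: contiguous_prefix_Nil)
    qed (use that cs' in \<open>auto simp: nodes_def filter_empty_conv intro!: contiguous_if_none\<close>)
    then show ?thesis by (auto simp: nodewise_contiguous_def)
  qed
  also have "\<dots> \<longleftrightarrow> (\<forall>p\<in>nodes PS. adjacent (prefix p) ?ws = length (filter (prefix p) ?ws) - 1)"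
    by (simp add: contiguous_iff_adjacent)
  \<comment> \<open>Each summand is bounded by its counterpart, so equality of the finite sums
    forces equality at every node.\<close>
  also have "\<dots> \<longleftrightarrow> total_overlap cs = overlap_bound PS"
    unfolding total overlap_bound_def len
    using sum_mono_inv[of "\<lambda>p. adjacent (prefix p) ?ws" "nodes PS"
        "\<lambda>p. length (filter (prefix p) ?ws) - 1", OF _ adjacent_le _ fin]
    by (auto intro: sum.cong)
  finally show "total_overlap cs = overlap_bound PS \<longleftrightarrow> nodewise_contiguous ?ws" by simp
qed

theorem theorem1:
  fixes sem :: "'g \<Rightarrow> 'u::monoid_mult"
    and PS :: "'g list set"
    and As :: "'g list"
  assumes "palindromic_set sem PS"
    and "PS \<noteq> {}"
  shows "maximal_overlap_sequence PS As \<longleftrightarrow> As \<in> mos (palindrome_trie PS)"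
proof -
  let ?T = "palindrome_trie PS"
  have paths: "paths ?T = gate_string ` PS"
    using paths_palindrome_trie[OF assms] by (simp add: gate_string_def)
  have "[] \<notin> paths ?T" by (auto simp: paths gate_string_def)
  then have "?T \<noteq> Trie fmempty" by (simp add: Nil_in_paths_iff)
  then have mos: "mos ?T =
      {map last ws |ws. ws \<in> permutations_of_set (gate_string ` PS) \<and> nodewise_contiguous ws}"
    by (simp add: mos_eq_nodewise_contiguous paths)
  have perms: "permutations_of_set (gate_string ` PS) = map gate_string ` permutations_of_set PS"
    using inj_on_gate_string[OF assms(1)] by (rule permutations_of_set_image_inj)
  have mos_iff: "xs \<in> mos ?T \<longleftrightarrow> (\<exists>cs\<in>permutations_of_set PS. xs = map middle cs \<and>
      total_overlap cs = overlap_bound PS)" for xs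
  proof -
    have last: "map last (map gate_string cs) = map middle cs" for cs
      by (simp add: last_gate_string)
    have "xs \<in> mos ?T \<longleftrightarrow> (\<exists>cs\<in>permutations_of_set PS. xs = map last (map gate_string cs) \<and>
        nodewise_contiguous (map gate_string cs))"
      unfolding mos perms by blast
    then show ?thesis
      unfolding last using total_overlap_bound(2)[OF assms(1)] by blast
  qed
  \<comment> \<open>A member of \<open>mos\<close> comes from an ordering attaining the bound, so
    the maximum of the total overlap is the bound itself.\<close>
  moreover obtain xs where "xs \<in> mos ?T" using mos_nonempty by blast
  ultimately obtain cs\<^sub>0 where "cs\<^sub>0 \<in> permutations_of_set PS" "total_overlap cs\<^sub>0 = overlap_bound PS"
    by blast
  then have "(\<forall>ds\<in>permutations_of_set PS. total_overlap ds \<le> total_overlap cs) \<longleftrightarrow>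
      total_overlap cs = overlap_bound PS" if "cs \<in> permutations_of_set PS" for cs
    using total_overlap_bound(1)[OF assms(1)] that by (metis order_antisym)
  then show ?thesis
    unfolding maximal_overlap_sequence_def mos_iff by blast
qed

end
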